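(* Every infinite finitely generated group $G$ admits a finite generating set $S$ such that the skeleton $X_{G,S}$ is not sofic.
   Context: All generating sets $S$ are finite, symmetric ($S=S^{-1}$) and do not contain the identity $1_G$. For $w\in S^*$, $\overline{w}\in G$ is the element represented by $w$; a factor is a finite contiguous subword. The skeleton is $X_{G,S}=\{x\in S^{\mathbb{Z}} : \overline{w}\neq 1_G \text{ for every nonempty finite factor } w \text{ of } x\}$. For a set $\mathcal{F}$ of finite words over a finite alphabet $A$, $\mathcal{X}_{\mathcal{F}}$ is the set of $x\in A^{\mathbb{Z}}$ having no factor in $\mathcal{F}$; a subshift is sofic if it equals $\mathcal{X}_{\mathcal{F}}$ for some regular language $\mathcal{F}$. *)

theory Defs
  imports "HOL-Algebra.Generated_Groups"
begin

definition factor :: "'a list \<Rightarrow> (int \<Rightarrow> 'a) \<Rightarrow> bool" where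
  "factor w x \<longleftrightarrow> (\<exists>i. w = map (\<lambda>k. x (i + int k)) [0..<length w])"

definition full_shift :: "'a set \<Rightarrow> (int \<Rightarrow> 'a) set" where
  "full_shift A = {x. range x \<subseteq> A}"

definition avoiding :: "'a set \<Rightarrow> 'a list set \<Rightarrow> (int \<Rightarrow> 'a) set" where
  "avoiding A F = {x \<in> full_shift A. \<forall>w\<in>F. \<not> factor w x}"

(* Acceptance by a deterministic finite automaton with state set Q, initial state q0,
   final states T and transition function d. Taking the states in nat loses no
   generality, since Q is finite. *)
definition regular_language :: "'a set \<Rightarrow> 'a list set \<Rightarrow> bool" where
  "regular_language A L \<longleftrightarrow>
     (\<exists>(Q :: nat set) q0 T d.
        finite Q \<and> q0 \<in> Q \<and> T \<subseteq> Q \<and> (\<forall>q\<in>Q. \<forall>a\<in>A. d q a \<in> Q) \<and>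
        L = {w \<in> lists A. foldl d q0 w \<in> T})"

definition sofic :: "'a set \<Rightarrow> (int \<Rightarrow> 'a) set \<Rightarrow> bool" where
  "sofic A X \<longleftrightarrow> finite A \<and> (\<exists>F. regular_language A F \<and> X = avoiding A F)"

definition finitely_generated_group :: "('a, 'b) monoid_scheme \<Rightarrow> bool" where
  "finitely_generated_group G \<longleftrightarrow>
     group G \<and> (\<exists>A. finite A \<and> A \<subseteq> carrier G \<and> generate G A = carrier G)"

(* Generating sets are finite, symmetric and do not contain the identity. *)
definition generating_set :: "('a, 'b) monoid_scheme \<Rightarrow> 'a set \<Rightarrow> bool" where
  "generating_set G S \<longleftrightarrow>
     finite S \<and> S \<subseteq> carrier G \<and> generate G S = carrier G \<and>
     set_inv\<^bsub>G\<^esub> S = S \<and> \<one>\<^bsub>G\<^esub> \<notin> S"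

definition word_value :: "('a, 'b) monoid_scheme \<Rightarrow> 'a list \<Rightarrow> 'a" where
  "word_value G w = foldr (\<otimes>\<^bsub>G\<^esub>) w \<one>\<^bsub>G\<^esub>"

definition skeleton :: "('a, 'b) monoid_scheme \<Rightarrow> 'a set \<Rightarrow> (int \<Rightarrow> 'a) set" where
  "skeleton G S =
     {x \<in> full_shift S. \<forall>w. w \<noteq> [] \<and> factor w x \<longrightarrow> word_value G w \<noteq> \<one>\<^bsub>G\<^esub>}"

end

theory Submission
  imports Defs
begin

text \<open>A sofic subshift is the set of labels of bi-infinite walks in a finite graph. Hence, if it is
  nonempty, it contains a periodic point; and among any infinite family of its points, two can be
  glued at position 0. Limits of geodesics show that the skeleton of an infinite group is nonempty,
  and a periodic point of the skeleton yields an element of infinite order, so a torsion group has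
  no sofic skeleton. If \<open>g\<close> has infinite order, put \<open>g\<close> and \<open>g\<^sup>3\<close> into \<open>S\<close>. A walk on the powers of \<open>g\<close>
  that comes from minus infinity in one residue class modulo 3, goes back \<open>m\<close> steps in a second one
  and then turns to a third one must make at least \<open>m\<close> steps there before it may return to the
  first class. A finite graph cannot remember \<open>m\<close>.\<close>

section \<open>Factors of bi-infinite sequences as windows\<close>

definition window :: "(int \<Rightarrow> 'a) \<Rightarrow> int \<Rightarrow> nat \<Rightarrow> 'a list" where
  "window x i n = map (\<lambda>k. x (i + int k)) [0..<n]"

lemma length_window [simp]: "length (window x i n) = n"
  by (simp add: window_def)

lemma window_0 [simp]: "window x i 0 = []"
  by (simp add: window_def)

lemma window_Suc: "window x i (Suc n) = window x i n @ [x (i + int n)]"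
  by (simp add: window_def)

lemma window_add: "window x i (m + n) = window x i m @ window x (i + int m) n"
  by (induction n) (simp_all add: window_Suc add.assoc)

lemma set_window_subset: "set (window x i n) \<subseteq> range x"
  by (auto simp: window_def)

lemma window_cong:
  "(\<And>k. k < n \<Longrightarrow> x (i + int k) = y (j + int k)) \<Longrightarrow> window x i n = window y j n"
  by (simp add: window_def)

lemma factor_iff: "factor w x \<longleftrightarrow> (\<exists>i n. w = window x i n)"
proof
  assume "\<exists>i n. w = window x i n"
  then obtain i n where w: "w = window x i n" by blast
  then have "w = map (\<lambda>k. x (i + int k)) [0..<length w]"
    by (simp add: window_def)
  then show "factor w x" unfolding factor_def by blast
qed (auto simp: factor_def window_def)

section \<open>Compactness: from long words to a bi-infinite word\<close>

text \<open>The inductive step of Koenig's lemma. If each of the finitely many pairs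
  \<open>(a, b)\<close> failed at some padding length, then longer paddings would fail too, since
  \<open>W\<close> is closed under factors. A padding beyond all these lengths would then refute the
  extendability of \<open>w\<close>.\<close>

lemma exists_extension_letters:
  assumes "finite A" and W: "W \<subseteq> lists A"
    and closed: "\<And>u w v. u @ w @ v \<in> W \<Longrightarrow> w \<in> W"
    and ext: "\<And>n. \<exists>u v. length u = n \<and> length v = n \<and> u @ w @ v \<in> W"
  shows "\<exists>a b. \<forall>n. \<exists>u v. length u = n \<and> length v = n \<and> u @ (a # w @ [b]) @ v \<in> W"
proof (rule ccontr)
  assume "\<not> ?thesis"
  then have "\<forall>a b. \<exists>n. \<forall>u v. length u = n \<longrightarrow> length v = n \<longrightarrow> u @ (a # w @ [b]) @ v \<notin> W"
    by blast
  then obtain N where N: "\<And>a b u v. length u = N a b \<Longrightarrow> length v = N a b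
      \<Longrightarrow> u @ (a # w @ [b]) @ v \<notin> W"
    by metis
  define M where "M = (\<Sum>(a, b)\<in>A \<times> A. N a b)"
  obtain u v where uv: "length u = Suc M" "length v = Suc M" "u @ w @ v \<in> W"
    using ext by blast
  obtain u' a where u: "u = u' @ [a]" using uv(1) by (metis length_Suc_conv_rev)
  obtain b v' where v: "v = b # v'" using uv(2) by (metis length_Suc_conv)
  have len: "length u' = M" "length v' = M" using uv u v by auto
  have ab: "a \<in> A" "b \<in> A" using uv(3) W u v by auto
  have le: "N a b \<le> M"
    using member_le_sum[of "(a, b)" "A \<times> A" "\<lambda>(a, b). N a b"] ab \<open>finite A\<close>
    by (simp add: M_def)
  \<comment> \<open>Cutting \<open>k\<close> letters from the left of \<open>u'\<close> leaves
    exactly the padding length at which the pair \<open>(a, b)\<close> fails.\<close>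
  define k where "k = M - N a b"
  have "u @ w @ v = take k u' @ (drop k u' @ (a # w @ [b]) @ take (N a b) v') @ drop (N a b) v'"
    by (simp add: u v)
  then have "drop k u' @ (a # w @ [b]) @ take (N a b) v' \<in> W"
    using uv(3) closed by metis
  then show False using N[of "drop k u'" a b "take (N a b) v'"] len le by (simp add: k_def)
qed

text \<open>Starting from the empty word, one letter is added at each end while two-sided
  extendability is kept. The resulting words are nested around a common centre, and \<open>x\<close>
  is their union.\<close>

lemma exists_biinfinite_word:
  assumes "finite A" and W: "W \<subseteq> lists A"
    and closed: "\<And>u w v. u @ w @ v \<in> W \<Longrightarrow> w \<in> W"
    and long: "\<And>n. \<exists>w\<in>W. n \<le> length w"
  shows "\<exists>x. range x \<subseteq> A \<and> (\<forall>i n. window x i n \<in> W)"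
proof -
  define ext where
    "ext w \<longleftrightarrow> (\<forall>n. \<exists>u v. length u = n \<and> length v = n \<and> u @ w @ v \<in> W)" for w
  have ext_Nil: "ext []"
    unfolding ext_def
  proof
    fix n
    obtain w where w: "w \<in> W" "2 * n \<le> length w" using long by blast
    have "[] @ (take n w @ [] @ take n (drop n w)) @ drop n (drop n w) \<in> W"
      using w(1) by (simp only: append_Nil append_assoc append_take_drop_id)
    then have "take n w @ [] @ take n (drop n w) \<in> W" by (rule closed)
    then show "\<exists>u v. length u = n \<and> length v = n \<and> u @ [] @ v \<in> W"
      using w(2) by (intro exI[of _ "take n w"] exI[of _ "take n (drop n w)"]) auto
  qed
  have "\<exists>f. \<forall>n. (ext (f n) \<and> length (f n) = 2 * n) \<and> (\<exists>a b. f (Suc n) = a # f n @ [b])"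
  proof (rule dependent_nat_choice)
    show "\<exists>w. ext w \<and> length w = 2 * 0" using ext_Nil by simp
    fix w n assume w: "ext w \<and> length w = 2 * n"
    have "\<exists>a b. ext (a # w @ [b])"
      unfolding ext_def
    proof (rule exists_extension_letters[OF \<open>finite A\<close> W])
      show "u @ v @ t \<in> W \<Longrightarrow> v \<in> W" for u v t by (rule closed)
      show "\<exists>u v. length u = n \<and> length v = n \<and> u @ w @ v \<in> W" for n
        using w unfolding ext_def by blast
    qed
    then obtain a b where "ext (a # w @ [b])" by blast
    then show "\<exists>w'. (ext w' \<and> length w' = 2 * Suc n) \<and> (\<exists>a b. w' = a # w @ [b])"
      using w by (intro exI[of _ "a # w @ [b]"]) auto
  qed
  then obtain f where f: "\<And>n. ext (f n)" "\<And>n. length (f n) = 2 * n"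
    "\<And>n. \<exists>a b. f (Suc n) = a # f n @ [b]" by blast
  have fW: "f n \<in> W" for n
    using f(1)[of n] unfolding ext_def by (metis append_Nil append_Nil2 length_0_conv)
  \<comment> \<open>Inside \<open>f (n + k)\<close> the word \<open>f n\<close> occupies the middle,
    at offset \<open>k\<close>.\<close>
  have shift: "f (n + k) ! (j + k) = f n ! j" if "j < 2 * n" for n k j
  proof (induction k)
    case (Suc k)
    obtain a b where "f (Suc (n + k)) = a # f (n + k) @ [b]" using f(3) by blast
    then show ?case using Suc f(2)[of "n + k"] that by (simp add: nth_append)
  qed simp
  \<comment> \<open>The word \<open>f n\<close> is laid on the positions from \<open>- n\<close> to
    \<open>n - 1\<close>. Position \<open>i\<close> is read off in the word of half-length
    \<open>\<bar>i\<bar> + 1\<close>, which always covers it.\<close>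
  define x where "x i = f (Suc (nat \<bar>i\<bar>)) ! nat (i + \<bar>i\<bar> + 1)" for i
  have x: "x (int j - int n) = f n ! j" if "j < 2 * n" for n j
  proof -
    define i where "i = int j - int n"
    \<comment> \<open>Only at the leftmost position of \<open>f n\<close> is the word that defines
      \<open>x i\<close> longer than \<open>f n\<close>, by one letter at each end.\<close>
    have le: "Suc (nat \<bar>i\<bar>) \<le> n \<or> i = - int n" using that by (auto simp: i_def)
    show ?thesis
    proof (cases "Suc (nat \<bar>i\<bar>) \<le> n")
      case True
      then obtain k where k: "n = Suc (nat \<bar>i\<bar>) + k" using le_Suc_ex by blast
      then have "j = nat (i + \<bar>i\<bar> + 1) + k" "nat (i + \<bar>i\<bar> + 1) < 2 * Suc (nat \<bar>i\<bar>)"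
        by (auto simp: i_def)
      then show ?thesis
        unfolding i_def[symmetric] x_def using shift k by metis
    next
      case False
      then have "j = 0" "i = - int n" using le by (auto simp: i_def)
      then show ?thesis using shift[of j n 1] that by (simp add: x_def)
    qed
  qed
  have whole: "window x (- int n) (2 * n) = f n" for n
    using x[of _ n] by (auto intro!: nth_equalityI simp: window_def f(2) algebra_simps)
  have win: "window x i n \<in> W" for i n
  proof -
    define N where "N = nat \<bar>i\<bar> + n"
    define k where "k = nat (i + int N)"
    define l where "l = 2 * N - (k + n)"
    have "2 * N = k + (n + l)" "- int N + int k = i" by (auto simp: N_def k_def l_def)
    then have "window x (- int N) (2 * N)
        = window x (- int N) k @ window x i n @ window x (i + int n) l"
      by (simp add: window_add)
    then show ?thesis using closed fW[of N] whole[of N] by metis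
  qed
  have "x i \<in> A" for i
    using win[of i 1] W by (auto simp: window_def)
  then show ?thesis using win by blast
qed

section \<open>Sofic subshifts as label sets of walks in finite graphs\<close>

text \<open>The states of the presentation are the sets of automaton states that the factors ending
  at a given position can reach; this makes the condition on \<open>x\<close> local.\<close>

lemma sofic_presentation:
  assumes "sofic A X"
  obtains V :: "nat set set" and E where "finite V"
    and "\<And>x. x \<in> X \<longleftrightarrow> x \<in> full_shift A \<and> (\<exists>P. \<forall>i. P i \<in> V \<and> E (P i) (x i) (P (i + 1)))"
proof -
  obtain F where F: "regular_language A F" "X = avoiding A F"
    using assms by (auto simp: sofic_def)
  obtain Q :: "nat set" and q0 T d where Q: "finite Q" "q0 \<in> Q" "T \<subseteq> Q"
    "\<And>q a. q \<in> Q \<Longrightarrow> a \<in> A \<Longrightarrow> d q a \<in> Q"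
    and F_eq: "F = {w \<in> lists A. foldl d q0 w \<in> T}"
    using F(1) unfolding regular_language_def by blast
  \<comment> \<open>Each state contains \<open>q0\<close> because a factor may start at any
    position, and avoids \<open>T\<close> because no factor may be accepted. Inclusion along edges
    suffices to trap every run in the states of the walk.\<close>
  define V where "V = {R. R \<subseteq> Q \<and> q0 \<in> R \<and> R \<inter> T = {}}"
  define E where "E R a R' \<longleftrightarrow> (\<forall>q\<in>R. d q a \<in> R')" for R R' a
  have "x \<in> X \<longleftrightarrow> (\<exists>P. \<forall>i. P i \<in> V \<and> E (P i) (x i) (P (i + 1)))" if x: "x \<in> full_shift A" for x
  proof
    have A: "range x \<subseteq> A" using x by (simp add: full_shift_def)
    assume "x \<in> X"
    define P where "P i = range (\<lambda>n. foldl d q0 (window x (i - int n) n))" for i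
    have "foldl d q0 (window x i n) \<in> Q" for i n
    proof (induction n)
      case (Suc n)
      moreover have "x (i + int n) \<in> A" using A by blast
      ultimately show ?case using Q(4) by (simp add: window_Suc)
    qed (simp add: Q(2))
    moreover have "q0 \<in> P i" for i
      by (auto simp: P_def intro!: range_eqI[of _ _ 0])
    moreover have "foldl d q0 (window x i n) \<notin> T" for i n
    proof
      assume "foldl d q0 (window x i n) \<in> T"
      then have "window x i n \<in> F"
        using set_window_subset[of x i n] A by (auto simp: F_eq)
      then show False using \<open>x \<in> X\<close> by (auto simp: F(2) avoiding_def factor_iff)
    qed
    ultimately have "P i \<in> V" for i by (auto simp: P_def V_def)
    moreover have "E (P i) (x i) (P (i + 1))" for i
      unfolding E_def P_def
    proof safe
      fix n
      have "d (foldl d q0 (window x (i - int n) n)) (x i)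
          = foldl d q0 (window x (i + 1 - int (Suc n)) (Suc n))"
        by (simp add: window_Suc)
      then show "d (foldl d q0 (window x (i - int n) n)) (x i)
          \<in> range (\<lambda>n. foldl d q0 (window x (i + 1 - int n) n))" by blast
    qed
    ultimately show "\<exists>P. \<forall>i. P i \<in> V \<and> E (P i) (x i) (P (i + 1))" by blast
  next
    assume "\<exists>P. \<forall>i. P i \<in> V \<and> E (P i) (x i) (P (i + 1))"
    then obtain P where P: "\<And>i. P i \<in> V" "\<And>i. E (P i) (x i) (P (i + 1))" by blast
    have "foldl d q0 (window x i n) \<in> P (i + int n)" for i n
    proof (induction n)
      case 0
      then show ?case using P(1)[of i] by (simp add: V_def)
    next
      case (Suc n)
      then show ?case using P(2)[of "i + int n"] by (simp add: window_Suc E_def algebra_simps)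
    qed
    then have "foldl d q0 (window x i n) \<notin> T" for i n
      using P(1)[of "i + int n"] unfolding V_def by blast
    then show "x \<in> X" using x by (auto simp: F(2) avoiding_def factor_iff F_eq)
  qed
  moreover have "X \<subseteq> full_shift A" by (auto simp: F(2) avoiding_def)
  moreover have "finite V" using Q(1) by (auto simp: V_def)
  ultimately show ?thesis using that[of V E] by blast
qed

text \<open>A walk in a finite graph visits some vertex twice; running around the loop between the
  two visits forever gives a periodic label.\<close>

lemma sofic_periodic_point:
  assumes "sofic A X" and "X \<noteq> {}"
  obtains y p where "y \<in> X" "p > 0" "\<And>i. y (i + int p) = y i"
proof -
  obtain V :: "nat set set" and E where V: "finite V"
    and X: "\<And>x. x \<in> X \<longleftrightarrow> x \<in> full_shift A \<and> (\<exists>P. \<forall>i. P i \<in> V \<and> E (P i) (x i) (P (i + 1)))"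
    using sofic_presentation[OF assms(1)] by metis
  obtain x where "x \<in> X" using assms(2) by blast
  then obtain P where x: "x \<in> full_shift A" and P: "\<And>i. P i \<in> V" "\<And>i. E (P i) (x i) (P (i + 1))"
    using X by blast
  have "\<not> inj_on (\<lambda>n. P (int n)) UNIV"
    using P(1) V by (metis finite_imageD finite_subset image_subset_iff infinite_UNIV_nat)
  then obtain m n where "m < n" and eq: "P (int m) = P (int n)"
    unfolding inj_on_def by (metis linorder_neqE_nat)
  define p where "p = n - m"
  define c where "c i = int m + i mod int p" for i
  have p: "p > 0" "int m + int p = int n" using \<open>m < n\<close> by (auto simp: p_def)
  \<comment> \<open>The time \<open>c (i + 1)\<close> differs from \<open>c i + 1\<close> only where
    the loop closes, and there the two states agree by \<open>eq\<close>.\<close>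
  have step: "P (c (i + 1)) = P (c i + 1)" for i
  proof -
    have mod: "(i + 1) mod int p = (i mod int p + 1) mod int p"
      by (simp add: mod_add_left_eq)
    have range: "0 \<le> i mod int p" "i mod int p < int p" using p(1) by auto
    show ?thesis
    proof (cases "i mod int p = int p - 1")
      case True
      then show ?thesis using mod eq p by (simp add: c_def)
    next
      case False
      then have "(i + 1) mod int p = i mod int p + 1"
        unfolding mod using range by (intro mod_pos_pos_trivial) auto
      then show ?thesis by (simp add: c_def add.assoc)
    qed
  qed
  show ?thesis
  proof (rule that)
    have "(\<lambda>i. x (c i)) \<in> full_shift A" using x by (auto simp: full_shift_def)
    moreover have "\<forall>i. P (c i) \<in> V \<and> E (P (c i)) (x (c i)) (P (c (i + 1)))"
      using P step by metis
    ultimately show "(\<lambda>i. x (c i)) \<in> X"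
      unfolding X by (intro conjI exI[of _ "\<lambda>i. P (c i)"])
    show "p > 0" by fact
    show "x (c (i + int p)) = x (c i)" for i by (simp add: c_def)
  qed
qed

text \<open>Among infinitely many walks, two are in the same state at time 0, so the past of one can
  be followed by the future of the other.\<close>

lemma sofic_splice:
  fixes x :: "nat \<Rightarrow> int \<Rightarrow> 'a"
  assumes "sofic A X" and "\<And>m. x m \<in> X"
  obtains m n where "m < n" "(\<lambda>i. if i < 0 then x n i else x m i) \<in> X"
proof -
  obtain V :: "nat set set" and E where V: "finite V"
    and X: "\<And>x. x \<in> X \<longleftrightarrow> x \<in> full_shift A \<and> (\<exists>P. \<forall>i. P i \<in> V \<and> E (P i) (x i) (P (i + 1)))"
    using sofic_presentation[OF assms(1)] by metis
  have "\<exists>P. \<forall>i. P i \<in> V \<and> E (P i) (x m i) (P (i + 1))" for m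
    using assms(2) X by blast
  then obtain P where P: "\<And>m i. P m i \<in> V" "\<And>m i. E (P m i) (x m i) (P m (i + 1))" by metis
  have "\<not> inj_on (\<lambda>m. P m 0) UNIV"
    using P(1) V by (metis finite_imageD finite_subset image_subset_iff infinite_UNIV_nat)
  then obtain m n where "m < n" and eq: "P m 0 = P n 0"
    unfolding inj_on_def by (metis linorder_neqE_nat)
  define R where "R i = (if i < 0 then P n i else P m i)" for i
  define z where "z i = (if i < 0 then x n i else x m i)" for i
  have "E (R i) (z i) (R (i + 1))" for i
  \<comment> \<open>This is the only edge across the seam: it ends in \<open>P n 0\<close>, which
    equals \<open>P m 0\<close>.\<close>
  proof (cases "i = - 1")
    case True
    then show ?thesis using P(2)[of n "- 1"] eq by (simp add: R_def z_def)
  next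
    case False
    then show ?thesis using P(2)[of n i] P(2)[of m i] by (auto simp: R_def z_def)
  qed
  moreover have "R i \<in> V" for i using P(1) by (simp add: R_def)
  moreover have "z \<in> full_shift A"
    using assms(2) X unfolding full_shift_def z_def by (auto simp: image_subset_iff)
  ultimately have "z \<in> X" unfolding X by blast
  then show ?thesis using that \<open>m < n\<close> unfolding z_def by blast
qed

section \<open>Words in a group, nonempty skeletons and their periodic points\<close>

lemma skeleton_iff:
  "x \<in> skeleton G S \<longleftrightarrow>
     range x \<subseteq> S \<and> (\<forall>i n. n > 0 \<longrightarrow> word_value G (window x i n) \<noteq> \<one>\<^bsub>G\<^esub>)"
  unfolding skeleton_def full_shift_def factor_iff
  by (auto simp flip: length_greater_0_conv) (metis length_greater_0_conv length_window)

context group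
begin

lemma word_value_Nil [simp]: "word_value G [] = \<one>"
  by (simp add: word_value_def)

lemma word_value_Cons [simp]: "word_value G (a # w) = a \<otimes> word_value G w"
  by (simp add: word_value_def)

lemma word_value_closed [simp]: "set w \<subseteq> carrier G \<Longrightarrow> word_value G w \<in> carrier G"
  by (induction w) auto

lemma word_value_append:
  "set u \<subseteq> carrier G \<Longrightarrow> set v \<subseteq> carrier G \<Longrightarrow>
     word_value G (u @ v) = word_value G u \<otimes> word_value G v"
  by (induction u) (auto simp: m_assoc)

lemma generating_set_symmetrization:
  assumes "finite B" "B \<subseteq> carrier G" "generate G B = carrier G"
  shows "generating_set G ((B \<union> m_inv G ` B) - {\<one>})" (is "generating_set G ?S")
proof -
  have S: "?S \<subseteq> carrier G" using assms(2) by auto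
  \<comment> \<open>Discarding the identity loses nothing, since it lies in every generated
    subgroup.\<close>
  have "B \<subseteq> generate G ?S"
    using generate.incl[of _ ?S G] generate.one[of G ?S] by blast
  then have "generate G B \<subseteq> generate G ?S"
    by (rule generate_subgroup_incl[OF _ generate_is_subgroup[OF S]])
  then have "generate G ?S = carrier G"
    using assms(3) generate_incl[OF S] by blast
  moreover have inv_S: "inv a \<in> ?S" if "a \<in> ?S" for a
    using that assms(2) by (auto simp: subset_iff)
  have "set_inv ?S = ?S"
  proof
    show "set_inv ?S \<subseteq> ?S" using inv_S by (auto simp: SET_INV_def)
    show "?S \<subseteq> set_inv ?S"
    proof
      fix a assume a: "a \<in> ?S"
      then have "inv (inv a) = a" using S by auto
      then show "a \<in> set_inv ?S" using inv_S[OF a] unfolding SET_INV_def by blast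
    qed
  qed
  ultimately show ?thesis using assms(1) S by (simp add: generating_set_def)
qed

lemma generate_word_value:
  assumes "generating_set G S" and "h \<in> carrier G"
  obtains w where "w \<in> lists S" "word_value G w = h"
proof -
  have S: "S \<subseteq> carrier G" "set_inv S = S" "generate G S = carrier G"
    using assms(1) by (auto simp: generating_set_def)
  have "\<exists>w\<in>lists S. word_value G w = h" if "h \<in> generate G S" for h
    using that
  proof induction
    case one
    show ?case by (intro bexI[of _ "[]"]) auto
  next
    case (incl h)
    then show ?case using S(1) by (intro bexI[of _ "[h]"]) auto
  next
    case (inv h)
    then have "inv h \<in> S" using S(2) by (auto simp: SET_INV_def)
    then show ?case using S(1) by (intro bexI[of _ "[inv h]"]) auto
  next
    case (eng h1 h2)
    then obtain u v where uv: "u \<in> lists S" "v \<in> lists S"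
      "word_value G u = h1" "word_value G v = h2" by blast
    then have "word_value G (u @ v) = h1 \<otimes> h2"
      using S(1) by (subst word_value_append) auto
    then show ?case using uv by (intro bexI[of _ "u @ v"]) auto
  qed
  then show ?thesis using that assms(2) S(3) by blast
qed

text \<open>A shortest word for an element has no nonempty factor of value 1, as deleting that
  factor would shorten it. In an infinite group such geodesic words are arbitrarily long, and
  compactness yields a bi-infinite limit.\<close>

lemma skeleton_nonempty:
  assumes gen: "generating_set G S" and inf: "infinite (carrier G)"
  shows "skeleton G S \<noteq> {}"
proof -
  have S: "finite S" "S \<subseteq> carrier G" using gen by (auto simp: generating_set_def)
  define W where "W = {w \<in> lists S. \<forall>u v t. w = u @ v @ t \<longrightarrow> v \<noteq> [] \<longrightarrow> word_value G v \<noteq> \<one>}"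
  have "\<exists>w\<in>W. n \<le> length w" for n
  proof -
    have "finite (word_value G ` {w. set w \<subseteq> S \<and> length w \<le> n})"
      using finite_lists_length_le[OF S(1)] by blast
    \<comment> \<open>Only finitely many elements are values of words of length at most
      \<open>n\<close>.\<close>
    then obtain h where h: "h \<in> carrier G"
      "h \<notin> word_value G ` {w. set w \<subseteq> S \<and> length w \<le> n}"
      using inf by (meson finite_subset subsetI)
    obtain w0 where "w0 \<in> lists S" "word_value G w0 = h"
      using generate_word_value[OF gen h(1)] by blast
    then obtain w where w: "w \<in> lists S \<and> word_value G w = h"
      and least: "\<And>w'. w' \<in> lists S \<and> word_value G w' = h \<Longrightarrow> length w \<le> length w'"
      using ex_has_least_nat[of "\<lambda>w. w \<in> lists S \<and> word_value G w = h" w0 length] by blast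
    have "word_value G v \<noteq> \<one>" if eq: "w = u @ v @ t" and "v \<noteq> []" for u v t
    proof
      assume v: "word_value G v = \<one>"
      have sub: "set u \<subseteq> carrier G" "set v \<subseteq> carrier G" "set t \<subseteq> carrier G"
        using w eq S(2) by auto
      then have "word_value G (u @ t) = word_value G w"
        using v by (simp add: eq word_value_append)
      then show False using least[of "u @ t"] w eq \<open>v \<noteq> []\<close> by auto
    qed
    then have "w \<in> W" using w by (auto simp: W_def)
    moreover have "n \<le> length w"
    proof (rule ccontr)
      assume "\<not> n \<le> length w"
      then have "word_value G w \<in> word_value G ` {w. set w \<subseteq> S \<and> length w \<le> n}"
        using w by (intro imageI) auto
      then show False using h(2) w by simp
    qed
    ultimately show ?thesis by blast
  qed
  moreover have "w \<in> W" if "u @ w @ v \<in> W" for u w v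
  proof -
    have "word_value G b \<noteq> \<one>" if "w = a @ b @ c" "b \<noteq> []" for a b c
    proof -
      have "u @ w @ v = (u @ a) @ b @ (c @ v)" using that by simp
      then show ?thesis using \<open>u @ w @ v \<in> W\<close> that(2) unfolding W_def by blast
    qed
    then show ?thesis using that by (auto simp: W_def)
  qed
  moreover have "W \<subseteq> lists S" by (auto simp: W_def)
  ultimately obtain x where x: "range x \<subseteq> S" "\<And>i n. window x i n \<in> W"
    using exists_biinfinite_word[OF S(1), of W] by metis
  have "word_value G (window x i n) \<noteq> \<one>" if "n > 0" for i n
  proof -
    have "window x i n = [] @ window x i n @ []" "window x i n \<noteq> []"
      using that by (auto simp flip: length_greater_0_conv)
    then show ?thesis using x(2)[of i n] unfolding W_def by blast
  qed
  then have "x \<in> skeleton G S" using x(1) by (simp add: skeleton_iff)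
  then show ?thesis by blast
qed

lemma word_value_window_periodic:
  assumes "range x \<subseteq> carrier G" and "\<And>i. x (i + int p) = x i"
  shows "word_value G (window x i (n * p)) = word_value G (window x i p) [^] n"
proof (induction n)
  case (Suc n)
  have period: "x (i + int (n * p)) = x i" for i
  proof (induction n)
    case (Suc n)
    then show ?case using assms(2)[of "i + int (n * p)"] by (simp add: algebra_simps)
  qed simp
  have "window x (i + int (n * p)) p = window x i p"
  proof (rule window_cong)
    fix k
    show "x (i + int (n * p) + int k) = x (i + int k)"
      using period[of "i + int k"] by (simp add: algebra_simps)
  qed
  then have "window x i (Suc n * p) = window x i (n * p) @ window x i p"
    by (simp add: window_add add.commute[of p])
  moreover have "set (window x i k) \<subseteq> carrier G" for k
    using set_window_subset[of x i k] assms(1) by blast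
  ultimately show ?case using Suc by (simp add: word_value_append)
qed simp

text \<open>The value of one period of a periodic point has infinite order: its \<open>n\<close>-th
  power is the value of \<open>n\<close> consecutive periods, a nonempty factor.\<close>

lemma sofic_skeleton_not_torsion:
  assumes gen: "generating_set G S" and "infinite (carrier G)" and "sofic S (skeleton G S)"
  obtains h where "h \<in> carrier G" "\<And>n::nat. n > 0 \<Longrightarrow> h [^] n \<noteq> \<one>"
proof -
  obtain y p where y: "y \<in> skeleton G S" "p > 0" "\<And>i. y (i + int p) = y i"
    using sofic_periodic_point[OF assms(3) skeleton_nonempty[OF assms(1,2)]] by metis
  have S: "range y \<subseteq> carrier G"
    using y(1) gen by (auto simp: skeleton_iff generating_set_def)
  show ?thesis
  proof (rule that)
    show "word_value G (window y 0 p) \<in> carrier G"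
      using set_window_subset[of y 0 p] S by (intro word_value_closed) blast
    fix n :: nat assume "n > 0"
    then have "word_value G (window y 0 (n * p)) \<noteq> \<one>"
      using y by (simp add: skeleton_iff)
    then show "word_value G (window y 0 p) [^] n \<noteq> \<one>"
      by (simp add: word_value_window_periodic[OF S y(3)])
  qed
qed

section \<open>Self-avoiding walks on the powers of an element of infinite order\<close>

text \<open>The letters are powers of \<open>g\<close> by the increments of \<open>P\<close>, so the
  product telescopes.\<close>

lemma word_value_window_int_pow:
  fixes P :: "int \<Rightarrow> int"
  assumes "g \<in> carrier G"
  shows "word_value G (window (\<lambda>i. g [^] (P (i + 1) - P i)) i n) = g [^] (P (i + int n) - P i)"
proof (induction n)
  case (Suc n)
  have "set (window (\<lambda>i. g [^] (P (i + 1) - P i)) i n) \<subseteq> carrier G"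
    using assms by (auto simp: window_def)
  then show ?case using Suc assms
    by (simp add: window_Suc word_value_append int_pow_mult[symmetric] add.commute add.left_commute)
qed simp

text \<open>A factor of value 1 is a return of the walk \<open>P\<close> to an earlier position, so
  avoiding such factors means that the walk is self-avoiding.\<close>

lemma skeleton_int_pow_iff:
  fixes P :: "int \<Rightarrow> int"
  assumes g: "g \<in> carrier G" and order: "\<And>n::int. g [^] n = \<one> \<Longrightarrow> n = 0"
  shows "(\<lambda>i. g [^] (P (i + 1) - P i)) \<in> skeleton G S \<longleftrightarrow>
    (\<forall>i. g [^] (P (i + 1) - P i) \<in> S) \<and> inj P"
proof -
  have "g [^] n = \<one> \<longleftrightarrow> n = 0" for n :: int using order by auto
  moreover have "(\<forall>i n. n > 0 \<longrightarrow> P (i + int n) - P i \<noteq> 0) \<longleftrightarrow> inj P"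
  proof
    assume L: "\<forall>i n. n > 0 \<longrightarrow> P (i + int n) - P i \<noteq> 0"
    have "P i \<noteq> P j" if "i < j" for i j
      using L[rule_format, of "nat (j - i)" i] that by simp
    then show "inj P" unfolding inj_def by (metis linorder_neqE)
  next
    assume "inj P"
    then show "\<forall>i n. n > 0 \<longrightarrow> P (i + int n) - P i \<noteq> 0"
      by (simp add: inj_eq)
  qed
  ultimately show ?thesis
    by (simp add: skeleton_iff word_value_window_int_pow[OF g] image_subset_iff)
qed

end

text \<open>The positions of the walk \<open>\<dots>333 1 (-3)\<^sup>m 1 . 3\<^sup>m 1 333\<dots>\<close> on the integers, where the dot marks
  time and position 0.\<close>

definition zigzag :: "nat \<Rightarrow> int \<Rightarrow> int" where
  "zigzag m i =
    (if i \<le> - int m - 2 then 3 * i + 6 * int m + 4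
     else if i < 0 then - 3 * i - 4
     else if i \<le> int m then 3 * i
     else 3 * i - 2)"

text \<open>The four branches are strictly monotone, with residues 1, 2, 0, 1 modulo 3. The two
  branches of residue 1 do not meet: the first stays at or below \<open>3 * m - 2\<close>, the last
  at or above \<open>3 * m + 1\<close>.\<close>

lemma inj_zigzag: "inj (zigzag m)"
proof (rule injI)
  fix i j assume "zigzag m i = zigzag m j"
  then show "i = j"
    unfolding zigzag_def by (auto split: if_splits) presburger+
qed

lemma zigzag_step: "zigzag m (i + 1) - zigzag m i \<in> {1, 3, - 3}"
  unfolding zigzag_def by auto

text \<open>On the way back to the right, the walk with past \<open>n\<close> and future \<open>m\<close> leaves its residue class
  modulo 3 too early and hits its own past.\<close>

lemma not_inj_zigzag_splice:
  assumes "m < n"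
  shows "\<not> inj (\<lambda>i. if i < 0 then zigzag n i else zigzag m i)"
proof
  assume "inj (\<lambda>i. if i < 0 then zigzag n i else zigzag m i)"
  \<comment> \<open>Both times are at position \<open>3 * m + 1\<close>: the later one is the first
    after the turn of \<open>zigzag m\<close>, and \<open>m < n\<close> puts the earlier one on the
    incoming ray of \<open>zigzag n\<close>.\<close>
  from injD[OF this, of "int m - 2 * int n - 1" "int m + 1"] assms
  show False by (simp add: zigzag_def)
qed

lemma (in group) skeleton_not_sofic_if_infinite_order:
  assumes g: "g \<in> carrier G" and order: "\<And>n::int. g [^] n = \<one> \<Longrightarrow> n = 0"
    and S: "{g, g [^] (3::int), g [^] (- 3::int)} \<subseteq> S"
  shows "\<not> sofic S (skeleton G S)"
proof
  assume sofic: "sofic S (skeleton G S)"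
  define x where "x m i = g [^] (zigzag m (i + 1) - zigzag m i)" for m i
  have "g [^] (zigzag m (i + 1) - zigzag m i) \<in> S" for m i
    using zigzag_step[of m i] S g by (auto simp: int_pow_1)
  then have "x m \<in> skeleton G S" for m
    unfolding x_def by (simp add: skeleton_int_pow_iff[OF g order] inj_zigzag)
  then obtain m n where "m < n" and splice: "(\<lambda>i. if i < 0 then x n i else x m i) \<in> skeleton G S"
    using sofic_splice[OF sofic] by metis
  define P where "P i = (if i < 0 then zigzag n i else zigzag m i)" for i
  have "(if i < 0 then x n i else x m i) = g [^] (P (i + 1) - P i)" for i
    \<comment> \<open>Every zigzag is at position 0 at time 0, so the increments also match across
      the seam.\<close>
    by (cases "i = - 1") (auto simp: x_def P_def zigzag_def)
  then have "(\<lambda>i. g [^] (P (i + 1) - P i)) \<in> skeleton G S" using splice by simp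
  then have "inj P" by (simp add: skeleton_int_pow_iff[OF g order])
  then show False using not_inj_zigzag_splice[OF \<open>m < n\<close>] unfolding P_def by blast
qed

section \<open>Choice of the generating set\<close>

theorem proposition5p4:
  fixes G :: "('a, 'b) monoid_scheme"
  assumes "finitely_generated_group G"
    and "infinite (carrier G)"
  shows "\<exists>S. generating_set G S \<and> \<not> sofic S (skeleton G S)"
proof -
  interpret group G using assms(1) by (simp add: finitely_generated_group_def)
  obtain A where A: "finite A" "A \<subseteq> carrier G" "generate G A = carrier G"
    using assms(1) by (auto simp: finitely_generated_group_def)
  let ?sym = "\<lambda>B. (B \<union> m_inv G ` B) - {\<one>\<^bsub>G\<^esub>}"
  show ?thesis
  proof (cases "\<exists>g\<in>carrier G. \<forall>n::int. g [^]\<^bsub>G\<^esub> n = \<one>\<^bsub>G\<^esub> \<longrightarrow> n = 0")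
    case True
    then obtain g where g: "g \<in> carrier G" and order: "\<And>n::int. g [^]\<^bsub>G\<^esub> n = \<one>\<^bsub>G\<^esub> \<Longrightarrow> n = 0"
      by blast
    \<comment> \<open>The walk needs the steps 1, 3 and -3; the last one comes from the
      symmetrization.\<close>
    define B where "B = insert g (insert (g [^]\<^bsub>G\<^esub> (3::int)) A)"
    have B: "finite B" "B \<subseteq> carrier G" using A g by (auto simp: B_def)
    have "carrier G \<subseteq> generate G B"
      using A(3) mono_generate[of A B] by (auto simp: B_def)
    then have "generating_set G (?sym B)"
      using B generate_incl[OF B(2)] by (intro generating_set_symmetrization) auto
    moreover have "\<not> sofic (?sym B) (skeleton G (?sym B))"
    proof (rule skeleton_not_sofic_if_infinite_order[OF g order])
      have "g [^]\<^bsub>G\<^esub> (- 3 :: int) = inv\<^bsub>G\<^esub> (g [^]\<^bsub>G\<^esub> (3 :: int))"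
        using g by (rule int_pow_neg)
      moreover have "g \<noteq> \<one>\<^bsub>G\<^esub>" using order[of 1] g by (auto simp: int_pow_1)
      moreover have "g [^]\<^bsub>G\<^esub> (3::int) \<noteq> \<one>\<^bsub>G\<^esub>" "g [^]\<^bsub>G\<^esub> (- 3::int) \<noteq> \<one>\<^bsub>G\<^esub>"
        using order[of 3] order[of "- 3"] by auto
      ultimately show "{g, g [^]\<^bsub>G\<^esub> (3::int), g [^]\<^bsub>G\<^esub> (- 3::int)} \<subseteq> ?sym B"
        by (auto simp: B_def)
    qed
    ultimately show ?thesis by blast
  next
    case False
    have gen: "generating_set G (?sym A)" using A by (rule generating_set_symmetrization)
    moreover have "\<not> sofic (?sym A) (skeleton G (?sym A))"
    proof
      assume "sofic (?sym A) (skeleton G (?sym A))"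
      then obtain h where h: "h \<in> carrier G" "\<And>n::nat. n > 0 \<Longrightarrow> h [^]\<^bsub>G\<^esub> n \<noteq> \<one>\<^bsub>G\<^esub>"
        using sofic_skeleton_not_torsion[OF gen assms(2)] by metis
      \<comment> \<open>The element \<open>h\<close> is known to have no trivial positive natural
        power; negative exponents reduce to these by inversion.\<close>
      have "n = 0" if n: "h [^]\<^bsub>G\<^esub> n = \<one>\<^bsub>G\<^esub>" for n :: int
      proof (cases n rule: int_cases2)
        case (nonneg k)
        then show ?thesis using n h(2)[of k] by (cases "k = 0") (auto simp: int_pow_int)
      next
        case (nonpos k)
        then have "h [^]\<^bsub>G\<^esub> k = \<one>\<^bsub>G\<^esub>"
          using n h(1) by (simp add: int_pow_neg_int)
        then show ?thesis using nonpos h(2)[of k] by (cases "k = 0") auto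
      qed
      then show False using False h(1) by blast
    qed
    ultimately show ?thesis by blast
  qed
qed

end
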